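(* Let $\mathcal{K}$ be the symmetric cone (cone of squares) of a Euclidean Jordan algebra $\mathcal{E}$, and let $\mathcal{F}$ be a face of $\mathcal{K}$. Then there exists an orthogonal projection $Q:\mathcal{E}\to\mathcal{E}$ such that $Q(\mathcal{K})=\mathcal{F}$. In particular, $\mathcal{K}$ is amenable, and $$\operatorname{dist}(x,\mathcal{F})=\operatorname{dist}(x,\mathcal{K})\qquad\text{for all } x\in\operatorname{span}\mathcal{F}.$$
   Context: A Euclidean Jordan algebra is a finite-dimensional real vector space $\mathcal{E}$ with a bilinear product $\circ$ (with identity element $e$) and an inner product such that $x\circ y=y\circ x$, $x\circ(x^2\circ y)=x^2\circ(x\circ y)$ with $x^2=x\circ x$, and $\langle x\circ y,z\rangle=\langle x,y\circ z\rangle$. Its cone of squares is $\mathcal{K}=\{x^2: x\in\mathcal{E}\}$, a symmetric cone. By the spectral theorem every $x$ is $\sum_{i=1}^r\lambda_ic_i$ with $c_i$ primitive idempotents, $c_i\circ c_j=0$ for $i\ne j$, $\sum c_i=e$, and unique real eigenvalues $\lambda_i$; $\operatorname{tr}x=\sum_i\lambda_i$. Throughout, the inner product is $\langle x,y\rangle=\operatorname{tr}(x\circ y)$, with induced norm $\|x\|=\sqrt{\operatorname{tr}(x^2)}$, and $\operatorname{dist}(x,C)=\inf\{\|x-y\|:y\in C\}$. A face of $\mathcal{K}$ is a convex cone $\mathcal{F}\subseteq\mathcal{K}$ such that $x,y\in\mathcal{K}$, $x+y\in\mathcal{F}$ imply $x,y\in\mathcal{F}$. A closed convex cone $\mathcal{K}$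 is amenable if for every face $\mathcal{F}$ of $\mathcal{K}$ there is a constant $\kappa>0$ such that $\operatorname{dist}(x,\mathcal{F})\le\kappa\operatorname{dist}(x,\mathcal{K})$ for all $x\in\operatorname{span}\mathcal{F}$. *)

theory Defs
  imports "HOL-Analysis.Analysis"
begin

locale euclidean_jordan_algebra =
  fixes jmul :: "'a::euclidean_space \<Rightarrow> 'a \<Rightarrow> 'a"
    and e :: 'a
  assumes bilinear: "bilinear jmul"
    and identity: "jmul e x = x"
    and commute: "jmul x y = jmul y x"
    and jordan: "jmul x (jmul (jmul x x) y) = jmul (jmul x x) (jmul x y)"
    and associative_inner: "jmul x y \<bullet> z = x \<bullet> jmul y z"

definition cone_of_squares :: "('a \<Rightarrow> 'a \<Rightarrow> 'a) \<Rightarrow> 'a set"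
  where "cone_of_squares jmul = {jmul x x | x. True}"

definition idempotent :: "('a \<Rightarrow> 'a \<Rightarrow> 'a) \<Rightarrow> 'a \<Rightarrow> bool"
  where "idempotent jmul c \<longleftrightarrow> jmul c c = c"

definition primitive_idempotent :: "('a::real_vector \<Rightarrow> 'a \<Rightarrow> 'a) \<Rightarrow> 'a \<Rightarrow> bool"
  where "primitive_idempotent jmul c \<longleftrightarrow>
    idempotent jmul c \<and> c \<noteq> 0 \<and>
    \<not> (\<exists>a b. idempotent jmul a \<and> idempotent jmul b \<and> a \<noteq> 0 \<and> b \<noteq> 0 \<and>
             jmul a b = 0 \<and> c = a + b)"

definition spectral_decomposition ::
    "('a::real_vector \<Rightarrow> 'a \<Rightarrow> 'a) \<Rightarrow> 'a \<Rightarrow> 'a \<Rightarrow> nat \<Rightarrow> (nat \<Rightarrow> 'a) \<Rightarrow> (nat \<Rightarrow> real) \<Rightarrow> bool"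
  where "spectral_decomposition jmul e x r c l \<longleftrightarrow>
    (\<forall>i<r. primitive_idempotent jmul (c i)) \<and>
    (\<forall>i<r. \<forall>j<r. i \<noteq> j \<longrightarrow> jmul (c i) (c j) = 0) \<and>
    (\<Sum>i<r. c i) = e \<and>
    x = (\<Sum>i<r. l i *\<^sub>R c i)"

text \<open>
  In a Euclidean Jordan algebra every element has a spectral decomposition, and its eigenvalues
  are unique up to order, so the description below picks out a single real number.
\<close>

definition jordan_trace :: "('a::real_vector \<Rightarrow> 'a \<Rightarrow> 'a) \<Rightarrow> 'a \<Rightarrow> 'a \<Rightarrow> real"
  where "jordan_trace jmul e x =
    (THE t. \<exists>r c l. spectral_decomposition jmul e x r c l \<and> t = (\<Sum>i<r. l i))"

text \<open>
  Unlike \<^const>\<open>face_of\<close>, this notion requires a face to be a nonempty cone; in particular the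
  empty set is not a face.
\<close>

definition cone_face :: "'a::real_vector set \<Rightarrow> 'a set \<Rightarrow> bool"
  where "cone_face F K \<longleftrightarrow>
    convex_cone F \<and> F \<subseteq> K \<and> (\<forall>x\<in>K. \<forall>y\<in>K. x + y \<in> F \<longrightarrow> x \<in> F \<and> y \<in> F)"

definition amenable :: "'a::real_normed_vector set \<Rightarrow> bool"
  where "amenable K \<longleftrightarrow>
    closed K \<and> convex_cone K \<and>
    (\<forall>F. cone_face F K \<longrightarrow>
      (\<exists>\<kappa>>0. \<forall>x\<in>span F. infdist x F \<le> \<kappa> * infdist x K))"

definition orthogonal_projection :: "('a::real_inner \<Rightarrow> 'a) \<Rightarrow> bool"
  where "orthogonal_projection Q \<longleftrightarrow>
    linear Q \<and> (\<forall>x. Q (Q x) = Q x) \<and> (\<forall>x y. Q x \<bullet> y = x \<bullet> Q y)"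

end

theory Submission
  imports Defs
begin

text \<open>
  A relative interior point of the face \<open>F\<close> has a spectral decomposition, and the sum \<open>c\<close> of its
  idempotents with positive eigenvalue lies in \<open>F\<close>. With \<open>L\<close> the multiplication by \<open>c\<close>, the map
  \<open>Q = 2 L\<^sup>2 - L\<close> is the orthogonal projection onto the Peirce space \<open>{v. c v = v}\<close>. Self-duality
  of the cone \<open>K\<close> shows that \<open>Q\<close> maps \<open>K\<close> into itself, and each element of \<open>Q K\<close> is dominated by a
  multiple of \<open>c\<close>, so \<open>Q K \<subseteq> F\<close>; conversely every element of \<open>F\<close> is dominated by a multiple of the
  interior point, hence fixed by \<open>Q\<close>. The distance formula follows because \<open>Q\<close> is nonexpansive.
  The spectral theorem is obtained variationally: the maximiser of \<open>(w w) \<bullet> w\<close> on the unit sphere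
  of an associative subalgebra is a multiple of a minimal idempotent, which is then split off.
\<close>

section \<open>Convex cones, faces and positive semidefinite operators\<close>

lemma convex_cone_sum:
  assumes "convex_cone K" "\<And>i. i \<in> S \<Longrightarrow> f i \<in> K"
  shows "(\<Sum>i\<in>S. f i) \<in> K"
  using assms(2)
  by (induction S rule: infinite_finite_induct)
    (use assms(1) in \<open>auto simp: convex_cone_iff\<close>)

lemma face_sum_member:
  assumes F: "cone_face F K" and "convex_cone K" "finite S" "\<And>i. i \<in> S \<Longrightarrow> f i \<in> K"
    and "(\<Sum>i\<in>S. f i) \<in> F" "i \<in> S"
  shows "f i \<in> F"
proof -
  have "(\<Sum>j\<in>S - {i}. f j) \<in> K" using assms(2,4) by (intro convex_cone_sum) auto
  moreover have "f i + (\<Sum>j\<in>S - {i}. f j) \<in> F"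
    using assms by (simp add: sum.remove[symmetric])
  ultimately show ?thesis using F assms(4,6) unfolding cone_face_def by blast
qed

text \<open>If \<open>L v\<close> were nonzero, the quadratic form of \<open>L\<close> would turn
  negative a short way from \<open>v\<close> in direction \<open>- L v\<close>: its value at
  \<open>v - t *\<^sub>R L v\<close> has first-order term \<open>- 2 * t * a\<close>.\<close>

lemma psd_kernel:
  fixes L :: "'a::real_inner \<Rightarrow> 'a"
  assumes "linear L" "\<And>x y. L x \<bullet> y = x \<bullet> L y" "\<And>y. 0 \<le> L y \<bullet> y" "L v \<bullet> v = 0"
  shows "L v = 0"
proof (rule ccontr)
  assume "L v \<noteq> 0"
  define a where "a = L v \<bullet> L v"
  define b where "b = L (L v) \<bullet> L v"
  have "a > 0" using \<open>L v \<noteq> 0\<close> by (simp add: a_def)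
  have "b \<ge> 0" using assms(3) by (simp add: b_def)
  \<comment> \<open>The summand 1 keeps the denominator positive when \<open>b = 0\<close> and still
    gives \<open>t * b \<le> a\<close>.\<close>
  define t where "t = a / (b + 1)"
  have "L (v - t *\<^sub>R L v) \<bullet> (v - t *\<^sub>R L v) = t * (t * b - 2 * a)"
    using assms(1,4) assms(2)[of "L v" v]
    by (simp add: linear_diff linear_scale inner_diff_left inner_diff_right a_def b_def algebra_simps)
  moreover have "t * b \<le> a"
    using \<open>a > 0\<close> \<open>b \<ge> 0\<close> by (simp add: t_def field_simps)
  then have "t * b - 2 * a < 0" using \<open>a > 0\<close> by simp
  moreover have "t > 0" using \<open>a > 0\<close> \<open>b \<ge> 0\<close> by (simp add: t_def)
  ultimately have "L (v - t *\<^sub>R L v) \<bullet> (v - t *\<^sub>R L v) < 0" by (simp add: mult_pos_neg)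
  then show False using assms(3)[of "v - t *\<^sub>R L v"] by simp
qed

section \<open>Bilinearity rules and the linearized Jordan identity\<close>

context euclidean_jordan_algebra
begin

lemmas jmul_simps =
  bilinear_ladd[OF bilinear] bilinear_radd[OF bilinear]
  bilinear_lsub[OF bilinear] bilinear_rsub[OF bilinear]
  bilinear_lmul[OF bilinear] bilinear_rmul[OF bilinear]
  bilinear_lneg[OF bilinear] bilinear_rneg[OF bilinear]
  bilinear_lzero[OF bilinear] bilinear_rzero[OF bilinear]

lemma linear_jmul: "linear (jmul x)"
  using bilinear by (simp add: bilinear_def)

lemma jmul_sum_right: "jmul x (\<Sum>i\<in>A. f i) = (\<Sum>i\<in>A. jmul x (f i))"
  by (rule linear_sum[OF linear_jmul])

lemma inner_jmul_commute: "jmul x y \<bullet> z = y \<bullet> jmul x z"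
  by (metis associative_inner commute)

lemma inner_square_identity: "jmul x x \<bullet> e = x \<bullet> x"
  by (metis associative_inner commute identity)

text \<open>Polarization: this is the part of the Jordan identity at \<open>x + z\<close> that is
  linear in \<open>z\<close>. Subtracting the instance at \<open>x - z\<close> leaves the odd part,
  and the instance at \<open>z\<close> removes the cubic term. Pairing with \<open>w\<close> makes
  this linear arithmetic over the reals.\<close>

lemma jordan_linearized:
  "jmul z (jmul (jmul x x) y) - jmul (jmul x x) (jmul z y)
    = 2 *\<^sub>R (jmul (jmul x z) (jmul x y) - jmul x (jmul (jmul x z) y))" (is "?l = ?r")
proof (rule vector_eq_rdot[THEN iffD1], rule allI)
  fix w
  have J: "jmul u (jmul (jmul u u) y) \<bullet> w = jmul (jmul u u) (jmul u y) \<bullet> w" for u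
    by (simp add: jordan)
  have zx: "jmul z x = jmul x z" by (rule commute)
  show "?l \<bullet> w = ?r \<bullet> w"
    using J[of "x + z"] J[of "x - z"] J[of z]
    by (simp add: jmul_simps zx inner_add_left inner_diff_left)
qed

text \<open>The linearized identity solved for multiplication by \<open>jmul (jmul x x) y\<close>.
  For \<open>y\<close> a power of \<open>x\<close> it becomes a recursion for multiplication by
  higher powers.\<close>

lemma jmul_square_mult:
  "jmul (jmul (jmul x x) y) z = jmul (jmul x x) (jmul y z)
    + 2 *\<^sub>R (jmul (jmul x y) (jmul x z) - jmul x (jmul y (jmul x z)))"
  using jordan_linearized[of z x y] by (simp add: commute algebra_simps)

subsection \<open>Power associativity\<close>

text \<open>The index is shifted by one: \<open>jpower x n\<close> is the power with exponent n + 1.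
  Leaving out the unit keeps all powers inside any product-closed subspace containing
  \<open>x\<close>.\<close>

primrec jpower :: "'a \<Rightarrow> nat \<Rightarrow> 'a" where
  "jpower x 0 = x"
| "jpower x (Suc n) = jmul x (jpower x n)"

lemma jmul_square_jpower: "jmul (jmul x x) (jpower x n) = jpower x (Suc (Suc n))"
proof (induction n)
  case 0
  show ?case by (simp add: commute)
next
  case (Suc n)
  have "jmul (jmul x x) (jpower x (Suc n)) = jmul x (jmul (jmul x x) (jpower x n))"
    by (simp add: jordan)
  with Suc show ?case by simp
qed

text \<open>By the recursion, multiplication by a power is a polynomial in the multiplications by
  \<open>x\<close> and by its square, so commuting with these two suffices.\<close>

lemma jpower_operator_commute:
  assumes "linear T"
    and T1: "\<And>z. T (jmul x z) = jmul x (T z)"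
    and T2: "\<And>z. T (jmul (jmul x x) z) = jmul (jmul x x) (T z)"
  shows "T (jmul (jpower x n) z) = jmul (jpower x n) (T z)"
proof (induction n arbitrary: z rule: induct_nat_012)
  case 0
  show ?case by (simp add: T1)
next
  case 1
  show ?case by (simp add: T2)
next
  case (ge2 n)
  have *: "jmul (jpower x (Suc (Suc n))) z = jmul (jmul x x) (jmul (jpower x n) z)
      + 2 *\<^sub>R (jmul (jpower x (Suc n)) (jmul x z) - jmul x (jmul (jpower x n) (jmul x z)))" for z
    using jmul_square_mult[of x "jpower x n" z] by (simp only: jmul_square_jpower jpower.simps)
  show ?case
    unfolding * using \<open>linear T\<close>
    by (simp add: linear_add linear_diff linear_scale ge2 T1 T2 del: jpower.simps)
qed

text \<open>The preceding lemma is used twice: multiplications by \<open>x\<close> and its square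
  commute with each other, hence with every power; so multiplication by a power qualifies as
  \<open>T\<close> in turn.\<close>

lemma jpower_commute:
  "jmul (jpower x m) (jmul (jpower x n) z) = jmul (jpower x n) (jmul (jpower x m) z)"
proof (rule jpower_operator_commute[OF linear_jmul])
  show "jmul (jpower x m) (jmul x z) = jmul x (jmul (jpower x m) z)" for z
    by (rule jpower_operator_commute[OF linear_jmul, symmetric]) (simp_all add: jordan)
  show "jmul (jpower x m) (jmul (jmul x x) z) = jmul (jmul x x) (jmul (jpower x m) z)" for z
    by (rule jpower_operator_commute[OF linear_jmul, symmetric]) (simp_all add: jordan)
qed

lemma jpower_mult: "jmul (jpower x m) (jpower x n) = jpower x (Suc (m + n))"
proof (induction n)
  case 0
  show ?case by (simp add: commute)
next
  case (Suc n)
  have "jmul (jpower x m) (jmul (jpower x 0) (jpower x n))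
      = jmul (jpower x 0) (jmul (jpower x m) (jpower x n))"
    by (rule jpower_commute)
  with Suc show ?case by simp
qed

lemma subspace_jmul_preimage: "subspace V \<Longrightarrow> subspace {a. jmul a b \<in> V}"
  by (auto simp: subspace_def jmul_simps)

lemma span_jmul_closed:
  assumes "a \<in> span S" "b \<in> span S" "\<And>u v. u \<in> S \<Longrightarrow> v \<in> S \<Longrightarrow> jmul u v \<in> span S"
  shows "jmul a b \<in> span S"
proof -
  have 1: "jmul c v \<in> span S" if "c \<in> span S" "v \<in> S" for c v
    using that(1)
    by (induction rule: span_induct) (use that assms(3) in \<open>auto intro!: subspace_jmul_preimage\<close>)
  have 2: "jmul v a \<in> span S" if "v \<in> S" for v
    using 1[OF assms(1) that] by (metis commute)
  have "jmul b a \<in> span S"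
    using assms(2) by (induction rule: span_induct) (auto intro!: subspace_jmul_preimage 2)
  then show ?thesis by (metis commute)
qed

lemma span_operator_commute:
  assumes "a \<in> span S" "b \<in> span S"
    and "\<And>u v z. u \<in> S \<Longrightarrow> v \<in> S \<Longrightarrow> jmul u (jmul v z) = jmul v (jmul u z)"
  shows "jmul a (jmul b z) = jmul b (jmul a z)"
proof -
  have sub: "subspace {a. \<forall>z. jmul a (jmul v z) = jmul v (jmul a z)}" for v
    by (auto simp: subspace_def jmul_simps)
  have 1: "\<forall>z. jmul c (jmul v z) = jmul v (jmul c z)" if "c \<in> span S" "v \<in> S" for c v
    using that(1) by (induction rule: span_induct) (use that assms(3) in \<open>auto intro!: sub\<close>)
  have "\<forall>z. jmul b (jmul a z) = jmul a (jmul b z)"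
    using assms(2) by (induction rule: span_induct) (use 1 assms(1) in \<open>auto intro!: sub\<close>)
  then show ?thesis by simp
qed

subsection \<open>The spectral theorem\<close>

definition orthogonal_idempotents :: "'a set \<Rightarrow> bool" where
  "orthogonal_idempotents D \<longleftrightarrow> finite D \<and> 0 \<notin> D \<and> (\<forall>d\<in>D. jmul d d = d) \<and>
    (\<forall>c\<in>D. \<forall>d\<in>D. c \<noteq> d \<longrightarrow> jmul c d = 0)"

text \<open>No unit is demanded, so that the annihilator of an idempotent inside such an algebra is
  again one.\<close>

definition associative_subalgebra :: "'a set \<Rightarrow> bool" where
  "associative_subalgebra A \<longleftrightarrow> subspace A \<and> (\<forall>a\<in>A. \<forall>b\<in>A. jmul a b \<in> A) \<and>
    (\<forall>a\<in>A. \<forall>b\<in>A. \<forall>c\<in>A. jmul (jmul a b) c = jmul a (jmul b c))"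

text \<open>Associativity comes from commuting multiplication operators: (a b) c = c (a b) = a (c b)
  = a (b c).\<close>

lemma associative_subalgebra_powers: "associative_subalgebra (span (range (jpower x)))"
proof -
  let ?A = "span (range (jpower x))"
  have closed: "jmul a b \<in> ?A" if "a \<in> ?A" "b \<in> ?A" for a b
    by (rule span_jmul_closed[OF that]) (auto simp: jpower_mult simp del: jpower.simps intro!: span_base)
  have comm: "jmul a (jmul b z) = jmul b (jmul a z)" if "a \<in> ?A" "b \<in> ?A" for a b z
    by (rule span_operator_commute[OF that]) (auto intro: jpower_commute)
  have "jmul (jmul a b) c = jmul a (jmul b c)" if "a \<in> ?A" "b \<in> ?A" "c \<in> ?A" for a b c
    by (metis comm commute that)
  then show ?thesis
    unfolding associative_subalgebra_def using closed by (simp add: subspace_span)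
qed

text \<open>The trilinear form \<open>jmul a b \<bullet> c\<close> is fully symmetric, hence the
  binomial coefficients.\<close>

lemma cubic_form_expand:
  "jmul (s *\<^sub>R u + t *\<^sub>R v) (s *\<^sub>R u + t *\<^sub>R v) \<bullet> (s *\<^sub>R u + t *\<^sub>R v)
    = s^3 * (jmul u u \<bullet> u) + 3 * s\<^sup>2 * t * (jmul u u \<bullet> v)
      + 3 * s * t\<^sup>2 * (jmul u v \<bullet> v) + t^3 * (jmul v v \<bullet> v)"
proof -
  have "jmul v u \<bullet> x = jmul u v \<bullet> x" for x by (metis commute)
  moreover have "jmul u v \<bullet> u = jmul u u \<bullet> v" "jmul v v \<bullet> u = jmul u v \<bullet> v"
    by (metis associative_inner commute)+
  ultimately show ?thesis
    by (simp add: jmul_simps inner_add_left inner_add_right power2_eq_square power3_eq_cube)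
      (simp add: algebra_simps)
qed

text \<open>Critical points of the cubic form on the unit sphere are multiples of idempotents.\<close>

lemma cubic_form_max:
  assumes A: "subspace A" "\<And>a b. a \<in> A \<Longrightarrow> b \<in> A \<Longrightarrow> jmul a b \<in> A" and "A \<noteq> {0}"
  obtains u l where "u \<in> A" "norm u = 1" "l > 0" "jmul u u = l *\<^sub>R u"
    "\<And>w. w \<in> A \<Longrightarrow> jmul w w \<bullet> w \<le> l * norm w ^ 3"
proof -
  define f where "f w = jmul w w \<bullet> w" for w
  have f_scale: "f (c *\<^sub>R w) = c^3 * f w" for c w
    by (simp add: f_def jmul_simps power3_eq_cube)
  have "compact (sphere 0 1 \<inter> A)"
    by (intro compact_Int_closed compact_sphere closed_subspace A)
  moreover obtain a where a: "a \<in> A" "a \<noteq> 0"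
    using \<open>A \<noteq> {0}\<close> subspace_0[OF A(1)] by auto
  have "inverse (norm a) *\<^sub>R a \<in> sphere 0 1 \<inter> A"
    using a A(1) by (simp add: subspace_scale)
  then have "sphere 0 1 \<inter> A \<noteq> {}" by blast
  moreover have "continuous_on (sphere 0 1 \<inter> A) f"
    unfolding f_def
    by (intro continuous_intros bilinear_continuous_on_compose[OF _ _ bilinear])
  ultimately obtain u where u: "u \<in> sphere 0 1 \<inter> A" "\<And>w. w \<in> sphere 0 1 \<inter> A \<Longrightarrow> f w \<le> f u"
    using continuous_attains_sup by metis
  have uA: "u \<in> A" and nu: "norm u = 1" using u(1) by auto
  have uu: "u \<bullet> u = 1" using nu by (simp add: norm_eq_sqrt_inner)
  have bound: "f w \<le> f u * norm w ^ 3" if "w \<in> A" for w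
  proof (cases "w = 0")
    case True
    then show ?thesis by (simp add: f_def)
  next
    case False
    have "f (inverse (norm w) *\<^sub>R w) \<le> f u"
      using False that A(1) by (intro u(2)) (simp add: subspace_scale)
    then have "inverse (norm w) ^ 3 * f w \<le> f u" by (simp only: f_scale)
    then show ?thesis using False by (simp add: field_simps)
  qed
  have critical: "jmul u u \<bullet> v = 0" if v: "v \<in> A" "v \<bullet> u = 0" for v
  proof (cases "v = 0")
    case True
    then show ?thesis by simp
  next
    case False
    define n where "n = inverse (norm v) *\<^sub>R v"
    have n: "n \<in> A" "n \<bullet> u = 0" "norm n = 1"
      using v False A(1) by (auto simp: n_def subspace_scale)
    have nn: "n \<bullet> n = 1" using n(3) by (simp add: norm_eq_sqrt_inner)
    \<comment> \<open>\<open>g\<close> compares both sides of the bound along the rational parametrisation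
      \<open>(1 - t\<^sup>2) u + 2 t n\<close>, of norm \<open>1 + t\<^sup>2\<close>, so that it is a polynomial.\<close>
    define g where "g t = (1 - t\<^sup>2)^3 * f u + 3 * (1 - t\<^sup>2)\<^sup>2 * (2 * t) * (jmul u u \<bullet> n)
      + 3 * (1 - t\<^sup>2) * (2 * t)\<^sup>2 * (jmul u n \<bullet> n) + (2 * t)^3 * f n - f u * (1 + t\<^sup>2)^3" for t :: real
    have g_le: "g t \<le> 0" for t
    proof -
      let ?w = "(1 - t\<^sup>2) *\<^sub>R u + (2 * t) *\<^sub>R n"
      have "(norm ?w)\<^sup>2 = (1 + t\<^sup>2)\<^sup>2"
        unfolding power2_norm_eq_inner using uu nn n(2)
        by (simp add: inner_add_left inner_add_right inner_commute[of u n])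
          (simp add: power2_eq_square algebra_simps)
      then have "norm ?w = 1 + t\<^sup>2"
        by (rule power2_eq_imp_eq) auto
      moreover have "?w \<in> A" using uA n(1) A(1) by (simp add: subspace_add subspace_scale)
      ultimately have "f ?w \<le> f u * (1 + t\<^sup>2)^3" using bound by metis
      then show ?thesis
        unfolding g_def f_def cubic_form_expand by simp
    qed
    have g0: "g 0 = 0" by (simp add: g_def)
    have "(g has_real_derivative 6 * (jmul u u \<bullet> n)) (at 0)"
      unfolding g_def by (auto intro!: derivative_eq_intros)
    then have "6 * (jmul u u \<bullet> n) = 0"
      by (rule DERIV_local_max[where d = 1]) (use g_le g0 in auto)
    then show ?thesis using False by (simp add: n_def)
  qed
  \<comment> \<open>\<open>w\<close> is the component of \<open>jmul u u\<close> orthogonal to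
    \<open>u\<close>; as a tangent direction inside \<open>A\<close> it is orthogonal to
    \<open>jmul u u\<close>, hence to itself.\<close>
  define w where "w = jmul u u - f u *\<^sub>R u"
  have "w \<in> A" using A uA by (simp add: w_def subspace_diff subspace_scale)
  moreover have wu: "w \<bullet> u = 0" by (simp add: w_def inner_diff_left f_def uu)
  ultimately have "jmul u u \<bullet> w = 0" by (rule critical)
  with wu have "w \<bullet> w = 0"
    by (simp add: w_def inner_diff_left inner_diff_right inner_commute)
  then have square: "jmul u u = f u *\<^sub>R u" by (simp add: w_def)
  have "f (- u) \<le> f u * norm (- u) ^ 3" using uA A(1) by (intro bound) (simp add: subspace_neg)
  then have "f u \<ge> 0" using nu by (simp add: f_def jmul_simps)
  \<comment> \<open>Otherwise \<open>jmul u u = 0\<close>, although its inner product with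
    \<open>e\<close> is \<open>u \<bullet> u = 1\<close>.\<close>
  moreover have "f u \<noteq> 0"
    using square inner_square_identity[of u] uu by auto
  ultimately have "f u > 0" by simp
  show ?thesis
    by (rule that[OF uA nu \<open>f u > 0\<close> square]) (use bound in \<open>simp add: f_def\<close>)
qed

text \<open>A second eigenvector for \<open>l\<close>, orthogonal to \<open>u\<close>, would let the
  cubic form exceed its maximum on a combination of the two.\<close>

lemma cubic_form_max_minimal:
  assumes A: "subspace A"
    and u: "u \<in> A" "norm u = 1" "l > 0" "jmul u u = l *\<^sub>R u"
    and max: "\<And>w. w \<in> A \<Longrightarrow> jmul w w \<bullet> w \<le> l * norm w ^ 3"
    and v: "v \<in> A" "jmul u v = l *\<^sub>R v" "v \<bullet> u = 0"
  shows "v = 0"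
proof (rule ccontr)
  assume "v \<noteq> 0"
  \<comment> \<open>The cubic form is odd, so a choice of sign makes it nonnegative at the unit
    vector \<open>n\<close>.\<close>
  define s :: real where "s = (if jmul v v \<bullet> v \<ge> 0 then 1 else -1)"
  define n where "n = (s / norm v) *\<^sub>R v"
  have "\<bar>s\<bar> = 1" by (simp add: s_def)
  then have n: "n \<in> A" "jmul u n = l *\<^sub>R n" "n \<bullet> u = 0" "norm n = 1"
    using v \<open>v \<noteq> 0\<close> A by (auto simp: n_def subspace_scale jmul_simps)
  have "jmul n n \<bullet> n = (s / norm v)^3 * (jmul v v \<bullet> v)"
    by (simp add: n_def jmul_simps power3_eq_cube)
  moreover have "s^3 * (jmul v v \<bullet> v) \<ge> 0" by (simp add: s_def)
  ultimately have pos: "jmul n n \<bullet> n \<ge> 0" by (simp add: power_divide)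
  have uu: "u \<bullet> u = 1" and nn: "n \<bullet> n = 1"
    using u(2) n(4) by (simp_all add: norm_eq_sqrt_inner)
  \<comment> \<open>The triple 3, 4, 5 gives an integral norm. The form takes at least the value (64
    + 108) l here, against the bound 125 l.\<close>
  let ?w = "4 *\<^sub>R u + 3 *\<^sub>R n"
  have "(norm ?w)\<^sup>2 = 5\<^sup>2"
    unfolding power2_norm_eq_inner using uu nn n(3)
    by (simp add: inner_add_left inner_add_right inner_commute[of u n])
  then have "norm ?w = 5" by (rule power2_eq_imp_eq) auto
  moreover have "?w \<in> A" using u n A by (simp add: subspace_add subspace_scale)
  ultimately have "jmul ?w ?w \<bullet> ?w \<le> l * 5 ^ 3" using max by metis
  then have "172 * l + 27 * (jmul n n \<bullet> n) \<le> 125 * l"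
    unfolding cubic_form_expand using u(4) n uu nn by (simp add: inner_commute[of u n])
  with pos u(3) show False by simp
qed

text \<open>The maximiser \<open>u\<close> is rescaled to an idempotent. For \<open>a\<close>
  orthogonal to \<open>u\<close>, associativity makes \<open>jmul u a\<close> an eigenvector for
  \<open>l\<close> orthogonal to \<open>u\<close>, so it vanishes. Multiplication by
  \<open>d\<close> on \<open>A\<close> is thus the orthogonal projection onto the line through
  \<open>d\<close>.\<close>

lemma exists_minimal_idempotent:
  assumes A: "associative_subalgebra A" and "A \<noteq> {0}"
  obtains d where "d \<in> A" "d \<noteq> 0" "jmul d d = d"
    "\<And>a. a \<in> A \<Longrightarrow> a \<bullet> d = 0 \<Longrightarrow> jmul d a = 0"
proof -
  have sub: "subspace A" and closed: "\<And>a b. a \<in> A \<Longrightarrow> b \<in> A \<Longrightarrow> jmul a b \<in> A"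
    and assoc: "\<And>a b c. a \<in> A \<Longrightarrow> b \<in> A \<Longrightarrow> c \<in> A \<Longrightarrow> jmul (jmul a b) c = jmul a (jmul b c)"
    using A by (auto simp: associative_subalgebra_def)
  obtain u l where u: "u \<in> A" "norm u = 1" "l > 0" "jmul u u = l *\<^sub>R u"
    and max: "\<And>w. w \<in> A \<Longrightarrow> jmul w w \<bullet> w \<le> l * norm w ^ 3"
    using cubic_form_max[OF sub closed \<open>A \<noteq> {0}\<close>] by metis
  show ?thesis
  proof (rule that[of "inverse l *\<^sub>R u"])
    show "inverse l *\<^sub>R u \<in> A" using u sub by (simp add: subspace_scale)
    show "inverse l *\<^sub>R u \<noteq> 0" using u by auto
    show "jmul (inverse l *\<^sub>R u) (inverse l *\<^sub>R u) = inverse l *\<^sub>R u"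
      using u by (simp add: jmul_simps)
    fix a assume a: "a \<in> A" "a \<bullet> inverse l *\<^sub>R u = 0"
    have "jmul u a = 0"
    proof (rule cubic_form_max_minimal[OF sub u max])
      show "jmul u a \<in> A" using closed u a by simp
      show "jmul u (jmul u a) = l *\<^sub>R jmul u a"
        using assoc[of u u a] u a by (simp add: jmul_simps)
      show "jmul u a \<bullet> u = 0"
        using a u by (simp add: inner_jmul_commute)
    qed
    then show "jmul (inverse l *\<^sub>R u) a = 0" by (simp add: jmul_simps)
  qed
qed

lemma associative_subalgebra_spanned:
  assumes "associative_subalgebra A"
  shows "\<exists>D. orthogonal_idempotents D \<and> D \<subseteq> A \<and> A \<subseteq> span D"
  using assms
proof (induction "dim A" arbitrary: A rule: less_induct)
  case less
  have sub: "subspace A" and closed: "\<And>a b. a \<in> A \<Longrightarrow> b \<in> A \<Longrightarrow> jmul a b \<in> A"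
    and assoc: "\<And>a b c. a \<in> A \<Longrightarrow> b \<in> A \<Longrightarrow> c \<in> A \<Longrightarrow> jmul (jmul a b) c = jmul a (jmul b c)"
    using less.prems by (auto simp: associative_subalgebra_def)
  show ?case
  proof (cases "A = {0}")
    case True
    then show ?thesis by (intro exI[of _ "{}"]) (auto simp: orthogonal_idempotents_def)
  next
    case False
    obtain d where d: "d \<in> A" "d \<noteq> 0" "jmul d d = d"
      and minimal: "\<And>a. a \<in> A \<Longrightarrow> a \<bullet> d = 0 \<Longrightarrow> jmul d a = 0"
      using exists_minimal_idempotent[OF less.prems False] by metis
    \<comment> \<open>By minimality of \<open>d\<close>, \<open>A\<close> is the line through
      \<open>d\<close> plus \<open>B\<close>, and \<open>B\<close> has smaller dimension.\<close>
    define B where "B = {a \<in> A. jmul d a = 0}"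
    have "subspace B"
      using sub by (auto simp: B_def subspace_def jmul_simps)
    have B: "associative_subalgebra B"
      unfolding associative_subalgebra_def
    proof (intro conjI ballI \<open>subspace B\<close>)
      fix a b assume "a \<in> B" "b \<in> B"
      then show "jmul a b \<in> B"
        using closed assoc[of d a b] d by (auto simp: B_def jmul_simps)
    next
      fix a b c assume "a \<in> B" "b \<in> B" "c \<in> B"
      then show "jmul (jmul a b) c = jmul a (jmul b c)"
        by (simp add: B_def assoc)
    qed
    have "d \<notin> B" using d by (simp add: B_def)
    moreover have "B \<subseteq> A" by (auto simp: B_def)
    ultimately have "B \<subset> A" using d(1) by blast
    then have "dim B < dim A"
      using \<open>subspace B\<close> sub by (intro dim_psubset) (simp add: span_eq_iff[THEN iffD2])
    then obtain D where D: "orthogonal_idempotents D" "D \<subseteq> B" "B \<subseteq> span D"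
      using less.hyps B by blast
    have "orthogonal_idempotents (insert d D)"
    proof -
      have "jmul d c = 0 \<and> jmul c d = 0" if "c \<in> D" for c
        using D(2) that commute[of c d] by (auto simp: B_def)
      then show ?thesis
        using D(1) d by (auto simp: orthogonal_idempotents_def)
    qed
    moreover have "insert d D \<subseteq> A" using d D(2) by (auto simp: B_def)
    moreover have "A \<subseteq> span (insert d D)"
    proof
      fix a assume a: "a \<in> A"
      define b where "b = a - ((a \<bullet> d) / (d \<bullet> d)) *\<^sub>R d"
      have "b \<in> A" using a d sub by (simp add: b_def subspace_diff subspace_scale)
      moreover have "b \<bullet> d = 0" using d by (simp add: b_def inner_diff_left)
      ultimately have "b \<in> B" using minimal by (simp add: B_def)
      then show "a \<in> span (insert d D)"
        using D(3) unfolding b_def span_breakdown_eq by blast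
    qed
    ultimately show ?thesis by blast
  qed
qed

text \<open>The powers of \<open>x\<close> span an associative subalgebra inside \<open>V\<close>.
  The parameter \<open>V\<close> allows the idempotents to be kept in a Peirce space later
  on.\<close>

lemma spectral:
  assumes V: "subspace V" "\<And>a b. a \<in> V \<Longrightarrow> b \<in> V \<Longrightarrow> jmul a b \<in> V" and "x \<in> V"
  obtains D l where "orthogonal_idempotents D" "D \<subseteq> V" "x = (\<Sum>d\<in>D. l d *\<^sub>R d)"
proof -
  let ?A = "span (range (jpower x))"
  obtain D where D: "orthogonal_idempotents D" "D \<subseteq> ?A" "?A \<subseteq> span D"
    using associative_subalgebra_spanned[OF associative_subalgebra_powers] by blast
  have "jpower x n \<in> V" for n
    by (induction n) (simp_all add: V \<open>x \<in> V\<close>)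
  then have "?A \<subseteq> V" using V(1) by (intro span_minimal) auto
  have "x \<in> ?A" by (rule span_base) (metis jpower.simps(1) rangeI)
  then have "x \<in> span D" using D(3) by blast
  moreover have "finite D" using D(1) by (simp add: orthogonal_idempotents_def)
  ultimately obtain l where "x = (\<Sum>d\<in>D. l d *\<^sub>R d)"
    by (auto simp: span_finite)
  then show ?thesis using that D \<open>?A \<subseteq> V\<close> by blast
qed

section \<open>Calculus of orthogonal idempotents\<close>

lemma jmul_orthogonal_sum:
  assumes "orthogonal_idempotents D" "c \<in> D"
  shows "jmul (\<Sum>d\<in>D. l d *\<^sub>R d) c = l c *\<^sub>R c"
proof -
  have "jmul c (\<Sum>d\<in>D. l d *\<^sub>R d) = (\<Sum>d\<in>D. l d *\<^sub>R jmul c d)"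
    by (simp add: jmul_sum_right jmul_simps)
  also have "\<dots> = (\<Sum>d\<in>D. if d = c then l d *\<^sub>R d else 0)"
    using assms by (intro sum.cong) (auto simp: orthogonal_idempotents_def)
  also have "\<dots> = l c *\<^sub>R c"
    using assms by (simp add: orthogonal_idempotents_def)
  finally show ?thesis by (metis commute)
qed

lemma jmul_orthogonal_sums:
  assumes "orthogonal_idempotents D"
  shows "jmul (\<Sum>d\<in>D. l d *\<^sub>R d) (\<Sum>d\<in>D. m d *\<^sub>R d) = (\<Sum>d\<in>D. (m d * l d) *\<^sub>R d)"
  unfolding jmul_sum_right
  by (intro sum.cong) (simp_all add: jmul_simps jmul_orthogonal_sum[OF assms])

lemma inner_orthogonal_sum:
  assumes "orthogonal_idempotents D" "c \<in> D"
  shows "(\<Sum>d\<in>D. l d *\<^sub>R d) \<bullet> c = l c * (c \<bullet> c)"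
proof -
  have "jmul c c = c" using assms by (simp add: orthogonal_idempotents_def)
  then show ?thesis
    using jmul_orthogonal_sum[OF assms, of l]
    by (metis associative_inner inner_scaleR_left)
qed

lemma idempotent_sum:
  assumes "orthogonal_idempotents D"
  shows "jmul (\<Sum>D) (\<Sum>D) = \<Sum>D"
  using jmul_orthogonal_sums[OF assms, of "\<lambda>_. 1" "\<lambda>_. 1"] by simp

subsection \<open>Peirce decomposition and the cone of squares\<close>

text \<open>In operator form L (2 L - 1) (L - 1) = 0, so the possible eigenvalues of multiplication
  by an idempotent are 0, 1/2 and 1.\<close>

lemma peirce_polynomial:
  assumes "jmul c c = c"
  shows "2 *\<^sub>R jmul c (jmul c (jmul c y)) = 3 *\<^sub>R jmul c (jmul c y) - jmul c y"
  using jmul_square_mult[of c c y] scaleR_left_distrib[of 2 1 "jmul c (jmul c y)"] assms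
  by (simp add: scaleR_diff_right algebra_simps)

text \<open>The linearized identity says that the difference of the two sides equals its own
  double.\<close>

lemma peirce_one_closed:
  assumes "jmul c c = c" "jmul c v = v" "jmul c w = w"
  shows "jmul c (jmul v w) = jmul v w"
proof -
  have "jmul v w - jmul c (jmul v w) = 2 *\<^sub>R (jmul v w - jmul c (jmul v w))"
    using jordan_linearized[of v c w] assms by simp
  then show ?thesis by (simp add: scaleR_2)
qed

lemma subspace_peirce_one: "subspace {v. jmul c v = v}"
  by (auto simp: subspace_def jmul_simps)

text \<open>For idempotent \<open>c\<close> this is the quadratic representation of
  \<open>c\<close>; the polynomial 2 t^2 - t takes the values 0, 0, 1 at the Peirce eigenvalues 0,
  1/2, 1.\<close>

definition peirce_projection :: "'a \<Rightarrow> 'a \<Rightarrow> 'a" where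
  "peirce_projection c y = 2 *\<^sub>R jmul c (jmul c y) - jmul c y"

lemma jmul_peirce_projection:
  assumes "jmul c c = c"
  shows "jmul c (peirce_projection c y) = peirce_projection c y"
  using peirce_polynomial[OF assms, of y] scaleR_left_distrib[of 2 1 "jmul c (jmul c y)"]
  by (simp add: peirce_projection_def jmul_simps)

lemma peirce_projection_fixed: "jmul c y = y \<Longrightarrow> peirce_projection c y = y"
  by (simp add: peirce_projection_def scaleR_2)

lemma peirce_projection_inner: "peirce_projection c x \<bullet> y = x \<bullet> peirce_projection c y"
  by (simp add: peirce_projection_def inner_diff_left inner_diff_right inner_jmul_commute)

lemma orthogonal_projection_peirce:
  assumes "jmul c c = c"
  shows "orthogonal_projection (peirce_projection c)"
  unfolding orthogonal_projection_def
proof (intro conjI allI)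
  show "linear (peirce_projection c)"
    by (rule linearI) (simp_all add: peirce_projection_def jmul_simps algebra_simps)
qed (simp_all add: jmul_peirce_projection[OF assms] peirce_projection_fixed peirce_projection_inner)

text \<open>With \<open>L\<close> the multiplication by \<open>c\<close>, the Peirce polynomial gives
  \<open>L = (2 L\<^sup>2 - L)\<^sup>2 + 8 (L - L\<^sup>2)\<^sup>2\<close>.\<close>

lemma idempotent_nonneg:
  assumes "jmul c c = c"
  shows "0 \<le> jmul c y \<bullet> y"
proof -
  define L where "L = jmul c"
  have L: "L (a + b) = L a + L b" "L (a - b) = L a - L b" "L (r *\<^sub>R a) = r *\<^sub>R L a"
    "L a \<bullet> b = a \<bullet> L b" for a b r
    by (simp_all add: L_def jmul_simps inner_jmul_commute)
  \<comment> \<open>Since \<open>L\<close> is self-adjoint, all inner products involved are such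
    moments, and the Peirce polynomial expresses \<open>p 3\<close> and \<open>p 4\<close> through
    \<open>p 1\<close> and \<open>p 2\<close>.\<close>
  define p where "p n = y \<bullet> (L ^^ n) y" for n
  have p: "2 * p (3 + n) = 3 * p (2 + n) - p (1 + n)" for n
  proof -
    have "y \<bullet> (2 *\<^sub>R L (L (L ((L ^^ n) y)))) = y \<bullet> (3 *\<^sub>R L (L ((L ^^ n) y)) - L ((L ^^ n) y))"
      unfolding L_def by (simp only: peirce_polynomial[OF assms])
    then show ?thesis
      by (simp add: p_def inner_diff_right numeral_eq_Suc)
  qed
  have "p 3 = (3 * p 2 - p 1) / 2" "p 4 = (3 * p 3 - p 2) / 2"
    using p[of 0] p[of 1] by (simp_all add: eval_nat_numeral)
  moreover have "(norm (2 *\<^sub>R L (L y) - L y))\<^sup>2 = 4 * p 4 - 4 * p 3 + p 2"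
    "(norm (L y - L (L y)))\<^sup>2 = p 2 - 2 * p 3 + p 4"
    unfolding power2_norm_eq_inner p_def
    by (simp_all add: L inner_diff_left inner_diff_right numeral_eq_Suc algebra_simps)
  ultimately have "p 1 = (norm (2 *\<^sub>R L (L y) - L y))\<^sup>2 + 8 * (norm (L y - L (L y)))\<^sup>2"
    by (simp add: field_simps)
  then have "p 1 \<ge> 0" by simp
  then show ?thesis by (simp add: p_def L_def inner_commute)
qed

section \<open>The cone of squares and its self-duality\<close>

lemma sum_idempotents_in_cone:
  assumes "orthogonal_idempotents D" "\<And>d. d \<in> D \<Longrightarrow> l d \<ge> 0"
  shows "(\<Sum>d\<in>D. l d *\<^sub>R d) \<in> cone_of_squares jmul"
proof -
  have "(\<Sum>d\<in>D. l d *\<^sub>R d) = jmul (\<Sum>d\<in>D. sqrt (l d) *\<^sub>R d) (\<Sum>d\<in>D. sqrt (l d) *\<^sub>R d)"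
    unfolding jmul_orthogonal_sums[OF assms(1)] by (intro sum.cong) (simp_all add: assms(2))
  then show ?thesis by (auto simp: cone_of_squares_def)
qed

lemma idempotent_in_cone: "jmul c c = c \<Longrightarrow> c \<in> cone_of_squares jmul"
  by (auto simp: cone_of_squares_def intro!: exI[of _ c])

text \<open>Pairing \<open>x\<close> with one of its own spectral idempotents \<open>d\<close> gives
  \<open>l d * (d \<bullet> d)\<close>, so testing against idempotents of \<open>V\<close>
  determines the signs.\<close>

lemma nonneg_spectral:
  assumes V: "subspace V" "\<And>a b. a \<in> V \<Longrightarrow> b \<in> V \<Longrightarrow> jmul a b \<in> V" and "x \<in> V"
    and nonneg: "\<And>d. d \<in> V \<Longrightarrow> jmul d d = d \<Longrightarrow> 0 \<le> x \<bullet> d"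
  obtains D l where "orthogonal_idempotents D" "D \<subseteq> V" "x = (\<Sum>d\<in>D. l d *\<^sub>R d)"
    "\<And>d. d \<in> D \<Longrightarrow> l d \<ge> 0"
proof -
  obtain D l where D: "orthogonal_idempotents D" "D \<subseteq> V" and x: "x = (\<Sum>d\<in>D. l d *\<^sub>R d)"
    using spectral[OF V \<open>x \<in> V\<close>] by metis
  have "l d \<ge> 0" if "d \<in> D" for d
  proof -
    have "0 \<le> x \<bullet> d" using that D by (intro nonneg) (auto simp: orthogonal_idempotents_def)
    then have "0 \<le> l d * (d \<bullet> d)" using inner_orthogonal_sum[OF D(1) that, of l] x by simp
    moreover have "d \<bullet> d > 0" using that D(1) by (auto simp: orthogonal_idempotents_def)
    ultimately show ?thesis by (simp add: zero_le_mult_iff)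
  qed
  then show ?thesis using that D x by metis
qed

text \<open>A square is a nonnegative combination of idempotents, whose multiplications are positive
  semidefinite. Conversely, idempotents are squares, so a member of the dual cone has nonnegative
  eigenvalues. The description by half-spaces yields closedness and convexity.\<close>

lemma cone_of_squares_self_dual:
  "cone_of_squares jmul = {x. \<forall>y. 0 \<le> x \<bullet> jmul y y}"
proof (intro equalityI subsetI CollectI allI)
  fix x y assume "x \<in> cone_of_squares jmul"
  then obtain z where z: "x = jmul z z" by (auto simp: cone_of_squares_def)
  obtain D l where D: "orthogonal_idempotents D" "z = (\<Sum>d\<in>D. l d *\<^sub>R d)"
    using spectral[of UNIV z] by auto
  have "x = (\<Sum>d\<in>D. (l d * l d) *\<^sub>R d)"
    using D by (simp add: z jmul_orthogonal_sums)
  then have "x \<bullet> jmul y y = (\<Sum>d\<in>D. (l d * l d) * (jmul d y \<bullet> y))"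
    by (simp add: inner_sum_left associative_inner)
  also have "\<dots> \<ge> 0"
  proof (rule sum_nonneg)
    fix d assume "d \<in> D"
    then have "0 \<le> jmul d y \<bullet> y"
      using D(1) by (intro idempotent_nonneg) (simp add: orthogonal_idempotents_def)
    then show "0 \<le> (l d * l d) * (jmul d y \<bullet> y)" by simp
  qed
  finally show "0 \<le> x \<bullet> jmul y y" .
next
  fix x assume "x \<in> {x. \<forall>y. 0 \<le> x \<bullet> jmul y y}"
  then have "0 \<le> x \<bullet> d" if "jmul d d = d" for d by (metis that mem_Collect_eq)
  then obtain D l where "orthogonal_idempotents D" "x = (\<Sum>d\<in>D. l d *\<^sub>R d)"
    "\<And>d. d \<in> D \<Longrightarrow> l d \<ge> 0"
    using nonneg_spectral[of UNIV x] by auto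
  then show "x \<in> cone_of_squares jmul" using sum_idempotents_in_cone by auto
qed

lemma cone_inner_idempotent:
  "x \<in> cone_of_squares jmul \<Longrightarrow> jmul d d = d \<Longrightarrow> 0 \<le> x \<bullet> d"
  by (metis (mono_tags, lifting) cone_of_squares_self_dual mem_Collect_eq)

lemma closed_cone_of_squares: "closed (cone_of_squares jmul)"
proof -
  have "cone_of_squares jmul = (\<Inter>y. {x. 0 \<le> jmul y y \<bullet> x})"
    by (auto simp: cone_of_squares_self_dual inner_commute)
  then show ?thesis by (auto intro!: closed_INT simp: closed_halfspace_ge)
qed

lemma convex_cone_of_squares: "convex_cone (cone_of_squares jmul)"
  by (auto simp: convex_cone_iff cone_of_squares_self_dual inner_add_left)

lemma cone_multiplication_psd:
  assumes "x \<in> cone_of_squares jmul" shows "0 \<le> jmul x y \<bullet> y"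
  using assms by (simp add: cone_of_squares_self_dual associative_inner)

text \<open>Multiplication by \<open>y\<close> is positive semidefinite and its form vanishes at the
  idempotent \<open>e - c\<close>, so it annihilates \<open>e - c\<close>.\<close>

lemma cone_orthogonal_complement:
  assumes "y \<in> cone_of_squares jmul" "jmul c c = c" "y \<bullet> (e - c) = 0"
  shows "jmul c y = y"
proof -
  have "jmul (e - c) (e - c) = e - c"
    using assms(2) by (simp add: jmul_simps identity commute[of c e])
  then have "jmul y (e - c) \<bullet> (e - c) = 0"
    using assms(3) by (simp add: associative_inner)
  then have "jmul y (e - c) = 0"
    by (intro psd_kernel[of "jmul y"] linear_jmul inner_jmul_commute
        cone_multiplication_psd assms(1))
  then show ?thesis by (simp add: jmul_simps identity commute[of y])
qed

text \<open>The eigenvalues of an element of the Peirce space are tested against idempotents of that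
  space, which the projection fixes.\<close>

lemma peirce_projection_spectral:
  assumes c: "jmul c c = c" and "x \<in> cone_of_squares jmul"
  obtains D l where "orthogonal_idempotents D" "\<And>d. d \<in> D \<Longrightarrow> jmul c d = d"
    "peirce_projection c x = (\<Sum>d\<in>D. l d *\<^sub>R d)" "\<And>d. d \<in> D \<Longrightarrow> l d \<ge> 0"
proof -
  let ?V = "{v. jmul c v = v}"
  have "0 \<le> peirce_projection c x \<bullet> d" if "d \<in> ?V" "jmul d d = d" for d
    using that cone_inner_idempotent[OF assms(2)]
    by (simp add: peirce_projection_inner peirce_projection_fixed)
  moreover have "jmul a b \<in> ?V" if "a \<in> ?V" "b \<in> ?V" for a b
    using peirce_one_closed[OF c] that by simp
  moreover have "peirce_projection c x \<in> ?V"
    using jmul_peirce_projection[OF c] by simp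
  ultimately obtain D l where "orthogonal_idempotents D" "D \<subseteq> ?V"
    "peirce_projection c x = (\<Sum>d\<in>D. l d *\<^sub>R d)" "\<And>d. d \<in> D \<Longrightarrow> l d \<ge> 0"
    using nonneg_spectral[OF subspace_peirce_one] by blast
  then show ?thesis by (intro that[of D l]) auto
qed

subsection \<open>Faces\<close>

lemma peirce_projection_in_face:
  assumes F: "cone_face F (cone_of_squares jmul)" and c: "jmul c c = c" "c \<in> F"
    and x: "x \<in> cone_of_squares jmul"
  shows "peirce_projection c x \<in> F"
proof -
  let ?K = "cone_of_squares jmul"
  obtain D l where D: "orthogonal_idempotents D" "\<And>d. d \<in> D \<Longrightarrow> jmul c d = d"
    and px: "peirce_projection c x = (\<Sum>d\<in>D. l d *\<^sub>R d)" and l: "\<And>d. d \<in> D \<Longrightarrow> l d \<ge> 0"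
    using peirce_projection_spectral[OF c(1) x] by metis
  have fin: "finite D" using D(1) by (simp add: orthogonal_idempotents_def)
  \<comment> \<open>The sum of the eigenvalues serves as an upper bound for them that also makes
    sense for empty \<open>D\<close>.\<close>
  define M where "M = (\<Sum>d\<in>D. l d)"
  have M: "l d \<le> M" if "d \<in> D" for d
    unfolding M_def using that l fin by (intro member_le_sum) auto
  have "M \<ge> 0" unfolding M_def using l by (intro sum_nonneg)
  have cD: "jmul c (\<Sum>D) = \<Sum>D" using D(2) by (simp add: jmul_sum_right)
  have "jmul (c - \<Sum>D) (c - \<Sum>D) = c - \<Sum>D"
    using cD c(1) idempotent_sum[OF D(1)] commute[of "\<Sum>D" c] by (simp add: jmul_simps)
  \<comment> \<open>\<open>M *\<^sub>R c\<close> minus the projection splits into this multiple of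
    an idempotent and a combination of \<open>D\<close> with coefficients \<open>M - l d\<close>,
    both in the cone; the face property then applies to \<open>M *\<^sub>R c\<close>.\<close>
  then have "M *\<^sub>R (c - \<Sum>D) \<in> ?K"
    using idempotent_in_cone \<open>M \<ge> 0\<close> convex_cone_of_squares convex_cone_scaleR by blast
  moreover have "(\<Sum>d\<in>D. (M - l d) *\<^sub>R d) \<in> ?K"
    using M by (intro sum_idempotents_in_cone D(1)) simp
  ultimately have "M *\<^sub>R (c - \<Sum>D) + (\<Sum>d\<in>D. (M - l d) *\<^sub>R d) \<in> ?K"
    by (rule convex_cone_add[OF convex_cone_of_squares])
  moreover have "M *\<^sub>R (c - \<Sum>D) + (\<Sum>d\<in>D. (M - l d) *\<^sub>R d) = M *\<^sub>R c - peirce_projection c x"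
    by (simp add: px scaleR_diff_left sum_subtractf scaleR_right.sum scaleR_diff_right)
  ultimately have "M *\<^sub>R c - peirce_projection c x \<in> ?K" by simp
  moreover have "peirce_projection c x \<in> ?K"
    using sum_idempotents_in_cone[OF D(1)] l px by simp
  moreover have "peirce_projection c x + (M *\<^sub>R c - peirce_projection c x) \<in> F"
    using F c(2) \<open>M \<ge> 0\<close> by (simp add: cone_face_def convex_cone_scaleR)
  ultimately show ?thesis using F unfolding cone_face_def by blast
qed

text \<open>The idempotent is the support of a relative interior point of the face.\<close>

lemma face_idempotent:
  assumes F: "cone_face F (cone_of_squares jmul)"
  obtains c where "jmul c c = c" "c \<in> F" "\<And>y. y \<in> F \<Longrightarrow> jmul c y = y"
proof -
  let ?K = "cone_of_squares jmul"
  have FK: "F \<subseteq> ?K" and cF: "convex_cone F" using F by (auto simp: cone_face_def)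
  then have "convex F" "F \<noteq> {}" by (auto simp: convex_cone_def)
  then obtain x where xri: "x \<in> rel_interior F"
    using rel_interior_eq_empty by blast
  then have xF: "x \<in> F" using rel_interior_subset by blast
  obtain D l where D: "orthogonal_idempotents D" and x: "x = (\<Sum>d\<in>D. l d *\<^sub>R d)"
    and l: "\<And>d. d \<in> D \<Longrightarrow> l d \<ge> 0"
    using nonneg_spectral[of UNIV x] cone_inner_idempotent[OF subsetD[OF FK xF]] by auto
  \<comment> \<open>Only for positive eigenvalues does \<open>l d *\<^sub>R d \<in> F\<close> yield
    \<open>d \<in> F\<close> by rescaling.\<close>
  define C where "C = {d \<in> D. l d > 0}"
  have C: "orthogonal_idempotents C" using D by (auto simp: C_def orthogonal_idempotents_def)
  have fin: "finite C" "finite D" using C D by (auto simp: orthogonal_idempotents_def)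
  have xC: "x = (\<Sum>d\<in>C. l d *\<^sub>R d)"
    unfolding x using fin l by (intro sum.mono_neutral_right) (force simp: C_def)+
  have idem: "jmul d d = d" if "d \<in> C" for d
    using that C by (auto simp: orthogonal_idempotents_def)
  define c where "c = \<Sum>C"
  have cc: "jmul c c = c" using idempotent_sum[OF C] by (simp add: c_def)
  have memF: "d \<in> F" if "d \<in> C" for d
  proof -
    have "l d *\<^sub>R d \<in> F"
    proof (rule face_sum_member[OF F convex_cone_of_squares fin(1), where f = "\<lambda>d. l d *\<^sub>R d"])
      show "l i *\<^sub>R i \<in> ?K" if "i \<in> C" for i
        using that idem idempotent_in_cone
        by (intro convex_cone_scaleR[OF convex_cone_of_squares]) (auto simp: C_def)
    qed (use xF xC that in auto)
    moreover have "0 < l d" using that by (simp add: C_def)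
    ultimately show ?thesis
      using convex_cone_scaleR[OF cF, of "inverse (l d)" "l d *\<^sub>R d"] by simp
  qed
  then have "c \<in> F" unfolding c_def using cF by (intro convex_cone_sum)
  have "jmul c d = d" if "d \<in> C" for d
    using jmul_orthogonal_sum[OF C that, of "\<lambda>_. 1"] by (simp add: c_def)
  then have cx: "jmul c x = x"
    by (simp add: xC jmul_sum_right jmul_simps)
  have ec: "jmul (e - c) (e - c) = e - c"
    using cc by (simp add: jmul_simps identity commute[of c e])
  have x0: "x \<bullet> (e - c) = 0"
    by (metis cx associative_inner commute identity inner_diff_right right_minus_eq)
  have "jmul c y = y" if y: "y \<in> F" for y
  proof (rule cone_orthogonal_complement)
    show "y \<in> ?K" using y FK by blast
    show "jmul c c = c" by (rule cc)
    have "y \<in> affine hull F" using y by (rule hull_inc)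
    \<comment> \<open>The segment from \<open>y\<close> to the relative interior point
      \<open>x\<close> extends beyond \<open>x\<close> within \<open>F\<close>. Pairing the new
      endpoint with \<open>e - c\<close>, which is orthogonal to \<open>x\<close>, bounds
      \<open>y \<bullet> (e - c)\<close> from above by 0.\<close>
    then obtain m where m: "m > 1" "(1 - m) *\<^sub>R y + m *\<^sub>R x \<in> F"
      using convex_rel_interior_if[OF \<open>convex F\<close> xri] by (metis order_refl)
    then have "0 \<le> ((1 - m) *\<^sub>R y + m *\<^sub>R x) \<bullet> (e - c)"
      using FK ec by (intro cone_inner_idempotent) auto
    then have "0 \<le> (1 - m) * (y \<bullet> (e - c))" using x0 by (simp add: inner_add_left)
    then have "y \<bullet> (e - c) \<le> 0" using m(1) by (simp add: zero_le_mult_iff)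
    moreover have "0 \<le> y \<bullet> (e - c)" using \<open>y \<in> ?K\<close> ec by (rule cone_inner_idempotent)
    ultimately show "y \<bullet> (e - c) = 0" by simp
  qed
  then show ?thesis using that cc \<open>c \<in> F\<close> by blast
qed

lemma face_projection:
  assumes F: "cone_face F (cone_of_squares jmul)"
  shows "\<exists>Q. orthogonal_projection Q \<and> Q ` cone_of_squares jmul = F"
proof -
  obtain c where c: "jmul c c = c" "c \<in> F" and fixed: "\<And>y. y \<in> F \<Longrightarrow> jmul c y = y"
    using face_idempotent[OF F] by metis
  have "peirce_projection c ` cone_of_squares jmul = F"
  proof
    show "peirce_projection c ` cone_of_squares jmul \<subseteq> F"
      using peirce_projection_in_face[OF F c] by blast
    show "F \<subseteq> peirce_projection c ` cone_of_squares jmul"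
      using F fixed peirce_projection_fixed by (force simp: cone_face_def image_iff)
  qed
  then show ?thesis using orthogonal_projection_peirce[OF c(1)] by blast
qed

end

section \<open>Distances under orthogonal projections and the final result\<close>

lemma orthogonal_projection_norm_le:
  assumes "orthogonal_projection Q"
  shows "norm (Q x) \<le> norm x"
proof -
  have "norm (Q x) * norm (Q x) = Q x \<bullet> x"
    using assms unfolding orthogonal_projection_def
    by (metis power2_eq_square power2_norm_eq_inner)
  also have "\<dots> \<le> norm (Q x) * norm x" by (rule norm_cauchy_schwarz)
  finally show ?thesis
    by (cases "Q x = 0") auto
qed

text \<open>\<open>Q\<close> fixes \<open>span F\<close> pointwise and is nonexpansive, so for each
  \<open>k \<in> K\<close> the point \<open>Q k\<close> of \<open>F\<close> is at least as close to
  \<open>x\<close> as \<open>k\<close>.\<close>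

lemma infdist_projected_subset:
  assumes Q: "orthogonal_projection Q" "Q ` K = F" and F: "F \<subseteq> K" "F \<noteq> {}" and x: "x \<in> span F"
  shows "infdist x F = infdist x K"
proof (rule antisym)
  show "infdist x K \<le> infdist x F" using F by (rule infdist_mono)
  have Q': "linear Q" "Q (Q y) = Q y" for y using Q(1) by (auto simp: orthogonal_projection_def)
  have "Q x = x"
    using x
  proof (induction rule: span_induct)
    case base
    then show ?case using \<open>linear Q\<close>
      by (auto simp: subspace_def linear_0 linear_add linear_scale)
  next
    case (step y)
    then show ?case using Q(2) Q'(2) by auto
  qed
  have "infdist x F \<le> dist x k" if "k \<in> K" for k
  proof -
    have "infdist x F \<le> dist x (Q k)" using that Q(2) by (intro infdist_le) auto
    also have "\<dots> = norm (Q (x - k))"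
      using \<open>Q x = x\<close> \<open>linear Q\<close> by (simp add: dist_norm linear_diff)
    also have "\<dots> \<le> dist x k"
      unfolding dist_norm by (rule orthogonal_projection_norm_le[OF Q(1)])
    finally show ?thesis .
  qed
  moreover have "K \<noteq> {}" using F by blast
  ultimately show "infdist x F \<le> infdist x K"
    by (simp add: infdist_notempty[of K] cINF_greatest)
qed

theorem proposition33:
  fixes jmul :: "'a::euclidean_space \<Rightarrow> 'a \<Rightarrow> 'a"
    and e :: 'a
    and F :: "'a set"
  assumes "euclidean_jordan_algebra jmul e"
    and "\<And>x y. x \<bullet> y = jordan_trace jmul e (jmul x y)"
    and "cone_face F (cone_of_squares jmul)"
  shows "(\<exists>Q. orthogonal_projection Q \<and> Q ` cone_of_squares jmul = F) \<and>
    amenable (cone_of_squares jmul) \<and>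
    (\<forall>x\<in>span F. infdist x F = infdist x (cone_of_squares jmul))"
proof -
  interpret euclidean_jordan_algebra jmul e by fact
  have dist: "infdist x G = infdist x (cone_of_squares jmul)"
    if G: "cone_face G (cone_of_squares jmul)" and "x \<in> span G" for G x
  proof -
    have "G \<subseteq> cone_of_squares jmul" "G \<noteq> {}"
      using G by (auto simp: cone_face_def convex_cone_def)
    then show ?thesis
      using face_projection[OF G] infdist_projected_subset \<open>x \<in> span G\<close> by blast
  qed
  \<comment> \<open>Equality of the distances gives amenability with constant 1 for every
    face.\<close>
  then have "amenable (cone_of_squares jmul)"
    unfolding amenable_def
    by (auto intro!: exI[of _ 1] simp: closed_cone_of_squares convex_cone_of_squares)
  then show ?thesis using face_projection[OF assms(3)] dist[OF assms(3)] by blast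
qed

end
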